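(* Let $n\ge1$, let $y\in\mathcal{M}_{n,2}$, and let $q\in\mathbb{R}[x_1,\dots,x_n]$ be a quadratic polynomial. Let $E(q)=\{x\in\mathbb{R}^n:q(x)=0\}$ and $S(q)=\{x\in\mathbb{R}^n:q(x)\ge0\}$. (i) Suppose $E(q)\ne\emptyset$. Then $M_1(y)\succeq0$ and $L_y(q)=0$ if and only if $y\in\overline{\mathcal{R}_{n,2}(E(q))}$. (ii) Suppose $S(q)\ne\emptyset$. Then $M_1(y)\succeq0$ and $L_y(q)\ge0$ if and only if $y\in\overline{\mathcal{R}_{n,2}(S(q))}$.
   Context: "Quadratic" means of total degree two. $\mathcal{M}_{n,2}$ is the set of all real families $y=(y_\alpha)_{\alpha\in\mathbb{Z}_+^n,|\alpha|\le2}$, where $|\alpha|=\alpha_1+\cdots+\alpha_n$, identified with $\mathbb{R}^{\binom{n+2}{2}}$ with its Euclidean topology; overlines denote closure. $M_1(y)$ is the $(n+1)\times(n+1)$ real symmetric matrix with rows and columns indexed by $\alpha,\beta\in\mathbb{Z}_+^n$, $|\alpha|,|\beta|\le1$, and $(\alpha,\beta)$ entry $y_{\alpha+\beta}$; $\succeq0$ means positive semidefinite. The Riesz functional is $L_y\big(\sum_{|\alpha|\le2}p_\alpha x^\alpha\big)=\sum_{|\alpha|\le2}p_\alpha y_\alpha$. For closed $K\subseteq\mathbb{R}^n$, $\mathcal{R}_{n,2}(K)$ is the set of $y\in\mathcal{M}_{n,2}$ for which there is a positive Borel measure $\mu$ on $\mathbb{R}^n$, supported in $K$, with $y_\alpha=\int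 x^\alpha\,d\mu(x)$ for all $|\alpha|\le2$. *)

theory Defs
  imports "HOL-Analysis.Analysis" "HOL-Library.Poly_Mapping"
begin

text \<open>The dimension \<open>n \<ge> 1\<close> is the cardinality of the index type \<open>'n :: finite\<close>. Multi-indices in
  \<open>\<int>\<^sub>+\<^sup>n\<close> are the elements of \<open>'n \<Rightarrow>\<^sub>0 nat\<close>, and polynomials in \<open>\<real>[x\<^sub>1, \<dots>, x\<^sub>n]\<close> are finitely
  supported coefficient families indexed by multi-indices.\<close>

type_synonym 'n real_mpoly = "('n \<Rightarrow>\<^sub>0 nat) \<Rightarrow>\<^sub>0 real"

definition mdeg :: "('n::finite \<Rightarrow>\<^sub>0 nat) \<Rightarrow> nat" where
  "mdeg \<alpha> = (\<Sum>i\<in>UNIV. Poly_Mapping.lookup \<alpha> i)"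

definition monomial_at :: "('n::finite \<Rightarrow>\<^sub>0 nat) \<Rightarrow> real ^ 'n \<Rightarrow> real" where
  "monomial_at \<alpha> x = (\<Prod>i\<in>UNIV. (x $ i) ^ Poly_Mapping.lookup \<alpha> i)"

definition mpoly_eval :: "('n::finite) real_mpoly \<Rightarrow> real ^ 'n \<Rightarrow> real" where
  "mpoly_eval p x = (\<Sum>\<alpha>\<in>Poly_Mapping.keys p. Poly_Mapping.lookup p \<alpha> * monomial_at \<alpha> x)"

text \<open>The zero polynomial gets total degree \<open>0\<close>.\<close>

definition total_degree :: "('n::finite) real_mpoly \<Rightarrow> nat" where
  "total_degree p = Max (insert 0 (mdeg ` Poly_Mapping.keys p))"

definition quadratic :: "('n::finite) real_mpoly \<Rightarrow> bool" where
  "quadratic p \<longleftrightarrow> total_degree p = 2"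

lemma finite_mdeg_le: "finite {\<alpha> :: 'n::finite \<Rightarrow>\<^sub>0 nat. mdeg \<alpha> \<le> d}"
proof (rule finite_imageD[where f = Poly_Mapping.lookup])
  have "Poly_Mapping.lookup \<alpha> i \<le> d" if "mdeg \<alpha> \<le> d" for \<alpha> :: "'n \<Rightarrow>\<^sub>0 nat" and i
    using that member_le_sum[of i UNIV "Poly_Mapping.lookup \<alpha>"] by (simp add: mdeg_def)
  then have "Poly_Mapping.lookup ` {\<alpha> :: 'n \<Rightarrow>\<^sub>0 nat. mdeg \<alpha> \<le> d} \<subseteq> (UNIV :: 'n set) \<rightarrow>\<^sub>E {..d}"
    by auto
  then show "finite (Poly_Mapping.lookup ` {\<alpha> :: 'n \<Rightarrow>\<^sub>0 nat. mdeg \<alpha> \<le> d})"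
    by (rule finite_subset) (simp add: finite_PiE)
  show "inj_on Poly_Mapping.lookup {\<alpha> :: 'n \<Rightarrow>\<^sub>0 nat. mdeg \<alpha> \<le> d}"
    by (auto simp: inj_on_def poly_mapping_eqI)
qed

typedef ('n::finite) index1 = "{\<alpha> :: 'n \<Rightarrow>\<^sub>0 nat. mdeg \<alpha> \<le> 1}"
  by (rule exI[of _ 0]) (simp add: mdeg_def)

typedef ('n::finite) index2 = "{\<alpha> :: 'n \<Rightarrow>\<^sub>0 nat. mdeg \<alpha> \<le> 2}"
  by (rule exI[of _ 0]) (simp add: mdeg_def)

instance index1 :: (finite) finite
proof
  show "finite (UNIV :: 'a index1 set)"
    using type_definition.Abs_image[OF type_definition_index1]
    by (metis finite_imageI finite_mdeg_le)
qed

instance index2 :: (finite) finite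
proof
  show "finite (UNIV :: 'a index2 set)"
    using type_definition.Abs_image[OF type_definition_index2]
    by (metis finite_imageI finite_mdeg_le)
qed

text \<open>The space \<open>\<M>\<^sub>n\<^sub>,\<^sub>2\<close>; its topology is that of the Euclidean space \<open>real ^ 'n index2\<close>.\<close>

type_synonym 'n moments2 = "real ^ 'n index2"

text \<open>The sum of two multi-indices of degree at most \<open>1\<close> has degree at most \<open>2\<close>, so \<open>Abs_index2\<close>
  is only used on its domain.\<close>

definition index_add :: "('n::finite) index1 \<Rightarrow> 'n index1 \<Rightarrow> 'n index2" where
  "index_add \<alpha> \<beta> = Abs_index2 (Rep_index1 \<alpha> + Rep_index1 \<beta>)"

lemma Rep_index_add: "Rep_index2 (index_add \<alpha> \<beta>) = Rep_index1 \<alpha> + Rep_index1 \<beta>"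
proof -
  have "mdeg (Rep_index1 \<alpha> + Rep_index1 \<beta>) = mdeg (Rep_index1 \<alpha>) + mdeg (Rep_index1 \<beta>)"
    by (simp add: mdeg_def lookup_add sum.distrib)
  also have "\<dots> \<le> 2"
    using Rep_index1[of \<alpha>] Rep_index1[of \<beta>] by simp
  finally show ?thesis
    by (simp add: index_add_def Abs_index2_inverse)
qed

definition moment_matrix1 :: "('n::finite) moments2 \<Rightarrow> real ^ 'n index1 ^ 'n index1" where
  "moment_matrix1 y = (\<chi> \<alpha> \<beta>. y $ index_add \<alpha> \<beta>)"

definition pos_semidef :: "real ^ 'm ^ 'm \<Rightarrow> bool" where
  "pos_semidef A \<longleftrightarrow> transpose A = A \<and> (\<forall>v. 0 \<le> v \<bullet> (A *v v))"

definition riesz :: "('n::finite) moments2 \<Rightarrow> 'n real_mpoly \<Rightarrow> real" where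
  "riesz y p = (\<Sum>\<alpha>\<in>UNIV. Poly_Mapping.lookup p (Rep_index2 \<alpha>) * y $ \<alpha>)"

text \<open>The condition \<open>AE x in \<mu>. x \<in> K\<close> says \<open>\<mu> (\<real>\<^sup>n - K) = 0\<close>, which for closed \<open>K\<close> means that the
  support of \<open>\<mu>\<close> is contained in \<open>K\<close>. Integrability is required explicitly because the Bochner
  integral of a non-integrable function is \<open>0\<close>; for \<open>\<alpha> = 0\<close> it forces \<open>\<mu>\<close> to be finite.\<close>

definition moment_cone2 :: "(real ^ 'n) set \<Rightarrow> (('n::finite) moments2) set" where
  "moment_cone2 K = {y. \<exists>\<mu> :: (real ^ 'n) measure.
     sets \<mu> = sets borel \<and> (AE x in \<mu>. x \<in> K) \<and>
     (\<forall>\<alpha>. integrable \<mu> (monomial_at (Rep_index2 \<alpha>)) \<and>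
          y $ \<alpha> = integral\<^sup>L \<mu> (monomial_at (Rep_index2 \<alpha>)))}"

definition zero_set :: "('n::finite) real_mpoly \<Rightarrow> (real ^ 'n) set" where
  "zero_set q = {x. mpoly_eval q x = 0}"

definition nonneg_set :: "('n::finite) real_mpoly \<Rightarrow> (real ^ 'n) set" where
  "nonneg_set q = {x. mpoly_eval q x \<ge> 0}"

end

theory Submission
  imports Defs "HOL-Library.Quadratic_Discriminant"
begin

text \<open>One direction is soft: positive semidefiniteness of \<open>M\<^sub>1(y)\<close> and the sign of \<open>L\<^sub>y(q)\<close> are
  closed conditions on \<open>y\<close>, and for the moments of a measure they follow by integrating the square
  of an affine function, respectively \<open>q\<close> itself (\<open>moment_cone2_pos_semidef\<close>,
  \<open>moment_cone2_riesz\<close>).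

  For the other direction, think of a vector \<open>w\<close> indexed by the multi-indices of degree at most \<open>1\<close>
  as a point in homogeneous coordinates: its constant entry \<open>t\<close> is the homogenizing coordinate.
  The matrix \<open>w w\<^sup>T\<close> is the moment matrix of the family \<open>square_moments w\<close>. If \<open>t \<noteq> 0\<close> this is the
  moment family of the mass \<open>t\<^sup>2\<close> at the affine point represented by \<open>w\<close>; if \<open>t = 0\<close> it is an atom
  at infinity. On such a family the Riesz functional takes \<open>q\<close> to \<open>B(w, w)\<close>, where \<open>B\<close> is the
  homogenized form of \<open>q\<close>.

  A positive semidefinite \<open>M\<^sub>1(y)\<close> is a sum of matrices \<open>w w\<^sup>T\<close> (\<open>pos_semidef_sum_rank_one\<close>), and the
  values \<open>B(w, w)\<close> add up to \<open>L\<^sub>y(q)\<close>. Following Sturm and Zhang, rotating pairs of summands makes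
  every single value nonnegative (\<open>rank_one_sum_rebalance\<close>); when \<open>L\<^sub>y(q) = 0\<close> they must then all
  vanish. Summands with \<open>t \<noteq> 0\<close> are now atoms in \<open>E(q)\<close> or \<open>S(q)\<close>.

  It remains to approximate the atoms at infinity by finite ones without leaving the cone
  \<open>B(w, w) = 0\<close> or \<open>B(w, w) \<ge> 0\<close> (\<open>isotropic_in_closure_off_hyperplane\<close>,
  \<open>nonneg_in_closure_off_hyperplane\<close>). Here both hypotheses enter: a point of \<open>E(q)\<close> or \<open>S(q)\<close>
  provides a direction leaving the hyperplane \<open>t = 0\<close>, and degree exactly two says that \<open>B\<close> does not
  vanish on that hyperplane, which gives room to correct the value of \<open>B\<close>. For an affine \<open>q\<close> this
  fails: with \<open>q = x\<^sub>1\<close> the atoms at infinity of \<open>E(q)\<close> all lie in one hyperplane, although every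
  direction is isotropic.\<close>

section \<open>Positive semidefinite matrices as sums of rank-one matrices\<close>

lemma pos_semidef_zero_imp_eq_zero:
  fixes A :: "real ^ 'm ^ 'm"
  assumes sym: "transpose A = A" and z: "\<And>v. v \<bullet> (A *v v) = 0"
  shows "A = 0"
proof -
  have "x \<bullet> (A *v y) = 0" for x y
  proof -
    have s: "y \<bullet> (A *v x) = x \<bullet> (A *v y)"
      by (metis dot_lmul_matrix inner_commute sym transpose_matrix_vector)
    show ?thesis
      using z[of "x + y"] z[of x] z[of y] s
      by (simp add: matrix_vector_right_distrib inner_add_left inner_add_right)
  qed
  then have "A *v y = 0" for y
    using inner_eq_zero_iff by blast
  then show ?thesis
    by (metis matrix_eq matrix_vector_mult_0)
qed

text \<open>Induction on the corank by deflation: if \<open>c = v\<^sup>TAv > 0\<close> and \<open>u = Av\<close>, subtracting \<open>u u\<^sup>T / c\<close> keeps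
  the matrix positive semidefinite and adds \<open>v\<close> to its kernel.\<close>

lemma pos_semidef_sum_rank_one:
  fixes A :: "real ^ 'm ^ 'm"
  assumes "pos_semidef A"
  shows "\<exists>ws. \<forall>i j. A $ i $ j = (\<Sum>w\<leftarrow>ws. w $ i * w $ j)"
  using assms
proof (induction "CARD('m) - dim {x. A *v x = 0}" arbitrary: A rule: less_induct)
  case less
  have sym: "transpose A = A" and psd: "\<And>v. 0 \<le> v \<bullet> (A *v v)"
    using less.prems by (auto simp: pos_semidef_def)
  have symij: "A $ j $ i = A $ i $ j" for i j
    by (metis sym transpose_def vec_lambda_beta)
  show ?case
  proof (cases "A = 0")
    case True
    then show ?thesis by (intro exI[of _ "[]"]) simp
  next
    case False
    then obtain v where "v \<bullet> (A *v v) \<noteq> 0"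
      using pos_semidef_zero_imp_eq_zero[OF sym] by blast
    then have pos: "v \<bullet> (A *v v) > 0" using psd[of v] by simp
    define u where "u = A *v v"
    define c where "c = v \<bullet> (A *v v)"
    have c: "c > 0" "v \<bullet> u = c" "u \<bullet> v = c" using pos by (simp_all add: c_def u_def inner_commute)
    define A' where "A' = (\<chi> i j. A $ i $ j - u $ i * u $ j / c)"
    have A'v: "A' *v x = A *v x - ((u \<bullet> x) / c) *\<^sub>R u" for x
      by (simp add: vec_eq_iff A'_def matrix_vector_mult_def inner_vec_def left_diff_distrib
          right_diff_distrib sum_subtractf sum_distrib_left sum_distrib_right
          sum_divide_distrib mult_ac)
    have adj: "v \<bullet> (A *v x) = u \<bullet> x" for x
      unfolding u_def by (metis dot_lmul_matrix sym transpose_matrix_vector)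
    \<comment> \<open>The new form at \<open>x\<close> is the old form at the component of \<open>x\<close> that is \<open>A\<close>-orthogonal to \<open>v\<close>.\<close>
    have psd': "0 \<le> x \<bullet> (A' *v x)" for x
    proof -
      let ?k = "(u \<bullet> x) / c"
      have "0 \<le> (x - ?k *\<^sub>R v) \<bullet> (A *v (x - ?k *\<^sub>R v))" by (rule psd)
      also have "\<dots> = x \<bullet> (A *v x) - ?k * (x \<bullet> u) - ?k * (u \<bullet> x) + ?k * ?k * c"
        by (simp add: matrix_vector_mult_diff_distrib matrix_vector_mult_scaleR inner_diff_left
            inner_diff_right adj u_def[symmetric] c algebra_simps)
      also have "\<dots> = x \<bullet> (A' *v x)"
        using c by (simp add: A'v inner_diff_right inner_commute)
      finally show ?thesis .
    qed
    have "transpose A' = A'"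
      by (simp add: vec_eq_iff transpose_def A'_def symij mult.commute)
    then have ps': "pos_semidef A'" using psd' by (simp add: pos_semidef_def)
    have sub: "subspace {x. M *v x = 0}" for M :: "real ^ 'm ^ 'm"
      by (simp add: subspace_def matrix_vector_right_distrib matrix_vector_mult_scaleR)
    have "{x. A *v x = 0} \<subset> {x. A' *v x = 0}"
    proof
      show "{x. A *v x = 0} \<subseteq> {x. A' *v x = 0}"
        using adj by (auto simp: A'v) (metis inner_zero_right)
      have "A' *v v = 0" using c by (simp add: A'v u_def)
      moreover have "A *v v \<noteq> 0" using pos by auto
      ultimately show "{x. A *v x = 0} \<noteq> {x. A' *v x = 0}" by auto
    qed
    then have "dim {x. A *v x = 0} < dim {x. A' *v x = 0}"
      by (intro dim_psubset) (simp add: span_eq_iff[THEN iffD2, OF sub])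
    moreover have "dim {x. A' *v x = 0} \<le> CARD('m)"
      using dim_subset_UNIV[of "{x. A' *v x = 0}"] by simp
    ultimately have "CARD('m) - dim {x. A' *v x = 0} < CARD('m) - dim {x. A *v x = 0}"
      by linarith
    from less.hyps[OF this ps']
    obtain ws where ws: "\<forall>i j. A' $ i $ j = (\<Sum>w\<leftarrow>ws. w $ i * w $ j)" by blast
    have "A $ i $ j = (\<Sum>w\<leftarrow>(1 / sqrt c) *\<^sub>R u # ws. w $ i * w $ j)" for i j
      using c by (simp add: ws[rule_format, symmetric] A'_def)
    then show ?thesis by blast
  qed
qed

section \<open>Rebalancing a sum of rank-one matrices along a quadratic form\<close>

text \<open>The pairs \<open>(x, y)\<close> and \<open>(x', y')\<close> differ by a rotation, so \<open>x x\<^sup>T + y y\<^sup>T = x' x'\<^sup>T + y' y'\<^sup>T\<close>. Testing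
  against an arbitrary bilinear \<open>h\<close> expresses this equality of tensors without naming a tensor
  product.\<close>

lemma bilinear_rotate:
  fixes h :: "'v::real_vector \<Rightarrow> 'v \<Rightarrow> real"
  assumes "bilinear h" and "c\<^sup>2 = 1 + s\<^sup>2"
  shows "h ((x + s *\<^sub>R y) /\<^sub>R c) ((x + s *\<^sub>R y) /\<^sub>R c) + h ((y - s *\<^sub>R x) /\<^sub>R c) ((y - s *\<^sub>R x) /\<^sub>R c)
       = h x x + h y y"
proof -
  have pos: "1 + s\<^sup>2 > 0" by (smt (verit) zero_le_power2)
  have "h ((x + s *\<^sub>R y) /\<^sub>R c) ((x + s *\<^sub>R y) /\<^sub>R c) + h ((y - s *\<^sub>R x) /\<^sub>R c) ((y - s *\<^sub>R x) /\<^sub>R c)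
      = ((1 + s\<^sup>2) * (h x x + h y y)) / c\<^sup>2"
    using assms(1)
    by (simp add: bilinear_ladd bilinear_radd bilinear_lsub bilinear_rsub bilinear_lmul
        bilinear_rmul algebra_simps power2_eq_square divide_inverse)
  then show ?thesis using pos by (simp add: assms(2))
qed

lemma quadratic_form_root_between:
  fixes B :: "'v::real_vector \<Rightarrow> 'v \<Rightarrow> real"
  assumes B: "bilinear B" and "B x x \<ge> 0" and "B y y < 0"
  shows "\<exists>s. B (x + s *\<^sub>R y) (x + s *\<^sub>R y) = 0"
proof -
  let ?b = "B x y + B y x"
  let ?s = "(- ?b + sqrt (discrim (B y y) ?b (B x x))) / (2 * B y y)"
  have "discrim (B y y) ?b (B x x) \<ge> 0"
    using assms by (simp add: discrim_def) (smt (verit) mult_nonpos_nonneg zero_le_power2)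
  then have "B y y * ?s\<^sup>2 + ?b * ?s + B x x = 0"
    using discriminant_nonneg[of "B y y" ?b "B x x" ?s] assms by simp
  moreover have "B (x + s *\<^sub>R y) (x + s *\<^sub>R y) = B y y * s\<^sup>2 + ?b * s + B x x" for s
    by (simp add: bilinear_ladd[OF B] bilinear_radd[OF B] bilinear_lmul[OF B] bilinear_rmul[OF B])
       (simp add: algebra_simps power2_eq_square)
  ultimately show ?thesis by metis
qed

text \<open>If some \<open>B(y, y)\<close> is negative, some \<open>B(x, x)\<close> is positive because the total is nonnegative. A
  rotation of the pair produces a vector with value \<open>0\<close>, which is set aside; the other
  vector carries the whole value of the pair, so the remaining, shorter list still has a
  nonnegative total. The conclusion quantifies over all bilinear \<open>h\<close> to say that
  the sum of the \<open>w w\<^sup>T\<close> is unchanged.\<close>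

lemma rank_one_sum_rebalance:
  fixes B :: "'v::real_vector \<Rightarrow> 'v \<Rightarrow> real"
  assumes B: "bilinear B" and "(\<Sum>w\<leftarrow>ws. B w w) \<ge> 0"
  shows "\<exists>ws'. (\<forall>h. bilinear h \<longrightarrow> (\<Sum>w\<leftarrow>ws'. h w w) = (\<Sum>w\<leftarrow>ws. h w w :: real)) \<and>
               (\<forall>w\<in>set ws'. B w w \<ge> 0)"
  using assms(2)
proof (induction ws rule: length_induct)
  case (1 ws)
  show ?case
  proof (cases "\<forall>w\<in>set ws. B w w \<ge> 0")
    case True
    then show ?thesis by blast
  next
    case False
    then obtain y where y: "y \<in> set ws" "B y y < 0" by force
    have "\<exists>x\<in>set ws. B x x > 0"
    proof (rule ccontr)
      assume "\<not> (\<exists>x\<in>set ws. B x x > 0)"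
      then have "(\<Sum>w\<leftarrow>remove1 y ws. B w w) \<le> 0"
        by (intro sum_list_nonpos) (auto dest: notin_set_remove1[THEN contrapos_pp] simp: not_less)
      then show False
        using 1(2) y sum_list_map_remove1[OF y(1), of "\<lambda>w. B w w"] by simp
    qed
    then obtain x where x: "x \<in> set ws" "B x x > 0" by blast
    define rest where "rest = remove1 y (remove1 x ws)"
    have yr: "y \<in> set (remove1 x ws)" using x y by (metis in_set_remove1 less_asym)
    have split: "(\<Sum>w\<leftarrow>ws. f w) = f x + (f y + (\<Sum>w\<leftarrow>rest. f w))" for f :: "'v \<Rightarrow> real"
      by (simp add: rest_def sum_list_map_remove1[OF x(1)] sum_list_map_remove1[OF yr])
    obtain s where s: "B (x + s *\<^sub>R y) (x + s *\<^sub>R y) = 0"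
      using quadratic_form_root_between[OF B less_imp_le[OF x(2)] y(2)] by blast
    define c where "c = sqrt (1 + s\<^sup>2)"
    have c: "c\<^sup>2 = 1 + s\<^sup>2" by (simp add: c_def)
    define x' where "x' = (x + s *\<^sub>R y) /\<^sub>R c"
    define y' where "y' = (y - s *\<^sub>R x) /\<^sub>R c"
    have rot: "h x' x' + h y' y' = h x x + h y y" if "bilinear h" for h :: "'v \<Rightarrow> 'v \<Rightarrow> real"
      unfolding x'_def y'_def by (rule bilinear_rotate[OF that c])
    have x'0: "B x' x' = 0"
      by (simp add: x'_def bilinear_lmul[OF B] bilinear_rmul[OF B] s)
    have "(\<Sum>w\<leftarrow>y' # rest. B w w) \<ge> 0"
      using rot[OF B] x'0 split[of "\<lambda>w. B w w"] 1(2) by simp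
    moreover have "length (y' # rest) < length ws"
      using x yr length_pos_if_in_set[OF yr] by (simp add: rest_def length_remove1)
    ultimately obtain ws' where ws': "\<forall>h. bilinear h \<longrightarrow>
        (\<Sum>w\<leftarrow>ws'. h w w) = (\<Sum>w\<leftarrow>y' # rest. h w w :: real)" "\<forall>w\<in>set ws'. B w w \<ge> 0"
      using 1(1) by blast
    show ?thesis
    proof (intro exI[of _ "x' # ws'"] conjI allI impI)
      fix h :: "'v \<Rightarrow> 'v \<Rightarrow> real" assume h: "bilinear h"
      then show "(\<Sum>w\<leftarrow>x' # ws'. h w w) = (\<Sum>w\<leftarrow>ws. h w w)"
        using rot[OF h] ws'(1) split[of "\<lambda>w. h w w"] by simp
    qed (use ws'(2) x'0 in auto)
  qed
qed

section \<open>Approximating directions at infinity\<close>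

text \<open>The approximants are \<open>w + r z + s v\<close> with \<open>s \<rightarrow> 0\<close>. As \<open>w\<close> and \<open>z\<close> are isotropic, the equation
  \<open>B(w + r z + s v, w + r z + s v) = 0\<close> is linear in \<open>r\<close>. Unless \<open>B(w, z) = 0\<close>, where already \<open>w + s z\<close> is
  isotropic, its solution \<open>r\<close> tends to \<open>0\<close>; and \<open>B(v, v) \<noteq> 0\<close> ensures \<open>r \<noteq> 0\<close>, so that the
  approximant leaves the hyperplane.\<close>

lemma isotropic_in_closure_off_hyperplane:
  fixes B :: "'v::real_normed_vector \<Rightarrow> 'v \<Rightarrow> real" and t :: "'v \<Rightarrow> real"
  assumes B: "bilinear B" and sym: "\<And>x y. B x y = B y x" and t: "linear t"
    and w: "t w = 0" "B w w = 0" and z: "t z \<noteq> 0" "B z z = 0" and v: "t v = 0" "B v v \<noteq> 0"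
  shows "w \<in> closure {x. t x \<noteq> 0 \<and> B x x = 0}"
proof -
  note bil = bilinear_ladd[OF B] bilinear_radd[OF B] bilinear_lmul[OF B] bilinear_rmul[OF B]
  note lin = linear_add[OF t] linear_diff[OF t] linear_scale[OF t]
  let ?T = "{x. t x \<noteq> 0 \<and> B x x = 0}"
  show ?thesis
  proof (cases "B w z = 0")
    case True
    have "((\<lambda>s. w + s *\<^sub>R z) \<longlongrightarrow> w + 0 *\<^sub>R z) (at (0::real))"
      by (intro tendsto_intros)
    moreover have "eventually (\<lambda>s. w + s *\<^sub>R z \<in> closure ?T) (at (0::real))"
    proof (rule eventually_mono[OF eventually_neq_at_within[of 0]])
      fix s :: real assume "s \<noteq> 0"
      then have "w + s *\<^sub>R z \<in> ?T" using True w z by (simp add: bil lin sym[of z w])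
      then show "w + s *\<^sub>R z \<in> closure ?T" by (rule subsetD[OF closure_subset])
    qed
    ultimately have "w + 0 *\<^sub>R z \<in> closure ?T"
      by (intro Lim_in_closed_set[OF closed_closure]) auto
    then show ?thesis by simp
  next
    case False
    \<comment> \<open>\<open>r s\<close> solves \<open>r * den s + s * num s = 0\<close>, the isotropy equation of \<open>w + r z + s v\<close>.\<close>
    define den where "den s = 2 * (B w z + s * B z v)" for s
    define num where "num s = 2 * B w v + s * B v v" for s
    define r where "r s = - (s * num s / den s)" for s
    have den0: "eventually (\<lambda>s. den s \<noteq> 0) (at 0)"
    proof (rule tendsto_imp_eventually_ne)
      show "(den \<longlongrightarrow> 2 * (B w z + 0 * B z v)) (at 0)"
        unfolding den_def by (intro tendsto_intros)
    qed (use False in simp)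
    have num0: "eventually (\<lambda>s. num s \<noteq> 0) (at 0)"
    proof (cases "B w v = 0")
      case True
      show ?thesis
        by (rule eventually_mono[OF eventually_neq_at_within[of 0]])
           (use True v in \<open>simp add: num_def\<close>)
    next
      case False
      show ?thesis
      proof (rule tendsto_imp_eventually_ne)
        show "(num \<longlongrightarrow> 2 * B w v + 0 * B v v) (at 0)"
          unfolding num_def by (intro tendsto_intros)
      qed (use False in simp)
    qed
    have "(r \<longlongrightarrow> - (0 * (2 * B w v + 0 * B v v) / (2 * (B w z + 0 * B z v)))) (at 0)"
      unfolding r_def num_def den_def by (intro tendsto_intros) (use False in simp)
    then have "(r \<longlongrightarrow> 0) (at 0)" by simp
    then have "((\<lambda>s. w + r s *\<^sub>R z + s *\<^sub>R v) \<longlongrightarrow> w + 0 *\<^sub>R z + 0 *\<^sub>R v) (at 0)"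
      by (intro tendsto_intros)
    moreover have "eventually (\<lambda>s. w + r s *\<^sub>R z + s *\<^sub>R v \<in> closure ?T) (at 0)"
      using den0 num0 eventually_neq_at_within[of 0]
    proof eventually_elim
      case (elim s)
      have "B (w + r s *\<^sub>R z + s *\<^sub>R v) (w + r s *\<^sub>R z + s *\<^sub>R v) = r s * den s + s * num s"
        unfolding den_def num_def
        using w z by (simp add: bil sym[of z w] sym[of v w] sym[of v z] algebra_simps)
      also have "\<dots> = 0" using elim by (simp add: r_def)
      finally have "B (w + r s *\<^sub>R z + s *\<^sub>R v) (w + r s *\<^sub>R z + s *\<^sub>R v) = 0" .
      moreover have "t (w + r s *\<^sub>R z + s *\<^sub>R v) \<noteq> 0"
        using elim w z v by (simp add: lin r_def)
      ultimately have "w + r s *\<^sub>R z + s *\<^sub>R v \<in> ?T" by blast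
      then show ?case by (rule subsetD[OF closure_subset])
    qed
    ultimately have "w + 0 *\<^sub>R z + 0 *\<^sub>R v \<in> closure ?T"
      by (intro Lim_in_closed_set[OF closed_closure]) auto
    then show ?thesis by simp
  qed
qed

text \<open>If \<open>B(w, w) > 0\<close>, a small step towards \<open>z\<close> keeps the form positive. If \<open>B(w, w) = 0\<close>, subtracting a
  multiple of \<open>t\<^sup>2\<close> makes \<open>z\<close> isotropic and changes nothing on the hyperplane; in affine terms this
  approximates within the level set of the quadratic polynomial through the given point.\<close>

lemma nonneg_in_closure_off_hyperplane:
  fixes B :: "'v::real_normed_vector \<Rightarrow> 'v \<Rightarrow> real" and t :: "'v \<Rightarrow> real"
  assumes B: "bilinear B" and sym: "\<And>x y. B x y = B y x" and t: "linear t"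
    and w: "t w = 0" "B w w \<ge> 0" and z: "t z \<noteq> 0" "B z z \<ge> 0" and v: "t v = 0" "B v v \<noteq> 0"
  shows "w \<in> closure {x. t x \<noteq> 0 \<and> B x x \<ge> 0}"
proof (cases "B w w = 0")
  case True
  define k where "k = B z z / (t z)\<^sup>2"
  define C where "C x y = B x y - k * (t x * t y)" for x y
  have "bilinear C"
    unfolding bilinear_def linear_iff C_def
    by (simp add: bilinear_ladd[OF B] bilinear_radd[OF B] bilinear_lmul[OF B]
        bilinear_rmul[OF B] linear_add[OF t] linear_scale[OF t] algebra_simps)
  moreover have "C x y = C y x" for x y by (simp add: C_def sym mult.commute)
  ultimately have "w \<in> closure {x. t x \<noteq> 0 \<and> C x x = 0}"
    using w z v True
    by (intro isotropic_in_closure_off_hyperplane[OF _ _ t, of C w z v])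
       (simp_all add: C_def k_def power2_eq_square)
  moreover have "{x. t x \<noteq> 0 \<and> C x x = 0} \<subseteq> {x. t x \<noteq> 0 \<and> B x x \<ge> 0}"
    using z by (auto simp: C_def k_def)
  ultimately show ?thesis using closure_mono by blast
next
  case False
  let ?T = "{x. t x \<noteq> 0 \<and> B x x \<ge> 0}"
  have expand: "B (w + s *\<^sub>R z) (w + s *\<^sub>R z) = B w w + s * (2 * B w z) + s * s * B z z" for s
    by (simp add: bilinear_ladd[OF B] bilinear_radd[OF B] bilinear_lmul[OF B]
        bilinear_rmul[OF B] sym[of z w] algebra_simps)
  have "((\<lambda>s. B w w + s * (2 * B w z) + s * s * B z z) \<longlongrightarrow>
      B w w + 0 * (2 * B w z) + 0 * 0 * B z z) (at 0)"
    by (intro tendsto_intros)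
  then have "eventually (\<lambda>s. B (w + s *\<^sub>R z) (w + s *\<^sub>R z) > 0) (at 0)"
    unfolding expand using False w by (intro order_tendstoD(1)) auto
  then have "eventually (\<lambda>s. w + s *\<^sub>R z \<in> closure ?T) (at 0)"
    using eventually_neq_at_within[of 0]
  proof eventually_elim
    case (elim s)
    then have "w + s *\<^sub>R z \<in> ?T"
      using w z by (simp add: linear_add[OF t] linear_scale[OF t])
    then show ?case by (rule subsetD[OF closure_subset])
  qed
  moreover have "((\<lambda>s. w + s *\<^sub>R z) \<longlongrightarrow> w + 0 *\<^sub>R z) (at 0)"
    by (intro tendsto_intros)
  ultimately have "w + 0 *\<^sub>R z \<in> closure ?T"
    by (intro Lim_in_closed_set[OF closed_closure]) auto
  then show ?thesis by simp
qed

section \<open>Multi-indices of degree two\<close>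

lemma mdeg_add: "mdeg (\<alpha> + \<beta>) = mdeg \<alpha> + mdeg \<beta>"
  by (simp add: mdeg_def lookup_add sum.distrib)

lemma mdeg_eq_0_iff: "mdeg \<alpha> = 0 \<longleftrightarrow> \<alpha> = 0"
  by (auto simp: mdeg_def intro: poly_mapping_eqI)

lemma mdeg_single: "mdeg (Poly_Mapping.single i k) = k"
  by (simp add: mdeg_def lookup_single when_def)

lemma split_off_single:
  fixes \<gamma> :: "'n::finite \<Rightarrow>\<^sub>0 nat"
  assumes "\<gamma> \<noteq> 0"
  shows "\<exists>i \<delta>. \<gamma> = Poly_Mapping.single i 1 + \<delta> \<and> mdeg \<gamma> = Suc (mdeg \<delta>)"
proof -
  obtain i where "Poly_Mapping.lookup \<gamma> i \<noteq> 0"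
    using assms by (metis lookup_zero poly_mapping_eqI)
  then have "\<gamma> = Poly_Mapping.single i 1 + (\<gamma> - Poly_Mapping.single i 1)"
    by (intro poly_mapping_eqI) (auto simp: lookup_add lookup_minus lookup_single when_def)
  then show ?thesis
    by (metis mdeg_add mdeg_single plus_1_eq_Suc)
qed

lemma mdeg_le_1_cases:
  assumes "mdeg \<alpha> \<le> 1"
  obtains "\<alpha> = 0" | i where "\<alpha> = Poly_Mapping.single i 1"
proof (cases "\<alpha> = 0")
  case False
  then obtain i \<delta> where d: "\<alpha> = Poly_Mapping.single i 1 + \<delta>" "mdeg \<alpha> = Suc (mdeg \<delta>)"
    using split_off_single by blast
  then have "\<delta> = 0" using assms by (simp flip: mdeg_eq_0_iff)
  then show ?thesis using d that(2) by simp
qed (use that(1) in simp)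

text \<open>A monomial of degree at most two has essentially one factorization into two monomials of degree
  at most one. This is why \<open>w\<^sub>\<alpha> w\<^sub>\<beta>\<close> depends on \<open>\<alpha> + \<beta>\<close> only, that is, why every rank-one matrix has
  the structure of a moment matrix \<open>M\<^sub>1\<close>.\<close>

lemma add_eq_add_mdeg_le_1:
  fixes a b c d :: "'n::finite \<Rightarrow>\<^sub>0 nat"
  assumes deg: "mdeg a \<le> 1" "mdeg b \<le> 1" "mdeg c \<le> 1" "mdeg d \<le> 1" and eq: "a + b = c + d"
  shows "a = c \<and> b = d \<or> a = d \<and> b = c"
proof -
  have "a = c \<or> a = d"
    using deg(1)
  proof (cases rule: mdeg_le_1_cases)
    case 1
    then have "mdeg c + mdeg d \<le> 1" using eq deg by (metis add_0 mdeg_add)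
    then have "c = 0 \<or> d = 0" by (simp flip: mdeg_eq_0_iff) linarith
    then show ?thesis using 1 by blast
  next
    case (2 i)
    have "Poly_Mapping.lookup (c + d) i \<noteq> 0"
      by (simp add: 2 eq[symmetric] lookup_add)
    then have "Poly_Mapping.lookup c i \<noteq> 0 \<or> Poly_Mapping.lookup d i \<noteq> 0"
      by (auto simp: lookup_add)
    moreover have "e = Poly_Mapping.single i 1" if "mdeg e \<le> 1" "Poly_Mapping.lookup e i \<noteq> 0" for e
      using that(1)
      by (cases rule: mdeg_le_1_cases)
         (use that(2) in \<open>auto simp: lookup_single when_def split: if_splits\<close>)
    ultimately show ?thesis using 2 deg by blast
  qed
  then show ?thesis using eq by (metis add_left_cancel add.commute)
qed

lemma index_add_commute: "index_add \<alpha> \<beta> = index_add \<beta> \<alpha>"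
  by (simp add: index_add_def add.commute)

lemma index_add_eq_iff:
  "index_add \<alpha> \<beta> = index_add \<alpha>' \<beta>' \<longleftrightarrow> \<alpha> = \<alpha>' \<and> \<beta> = \<beta>' \<or> \<alpha> = \<beta>' \<and> \<beta> = \<alpha>'"
proof
  assume "index_add \<alpha> \<beta> = index_add \<alpha>' \<beta>'"
  then have "Rep_index1 \<alpha> + Rep_index1 \<beta> = Rep_index1 \<alpha>' + Rep_index1 \<beta>'"
    by (metis Rep_index_add)
  then show "\<alpha> = \<alpha>' \<and> \<beta> = \<beta>' \<or> \<alpha> = \<beta>' \<and> \<beta> = \<alpha>'"
    using add_eq_add_mdeg_le_1 Rep_index1 Rep_index1_inject by (metis mem_Collect_eq)
qed (auto simp: index_add_commute)

lemma ex_index_add: "\<exists>\<alpha> \<beta>. \<gamma> = index_add \<alpha> \<beta>"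
proof -
  have "\<exists>a b. mdeg a \<le> 1 \<and> mdeg b \<le> 1 \<and> Rep_index2 \<gamma> = a + b"
  proof (cases "Rep_index2 \<gamma> = 0")
    case True
    then show ?thesis by (intro exI[of _ 0]) (simp add: mdeg_def)
  next
    case False
    then obtain i \<delta> where d: "Rep_index2 \<gamma> = Poly_Mapping.single i 1 + \<delta>"
      "mdeg (Rep_index2 \<gamma>) = Suc (mdeg \<delta>)"
      using split_off_single by blast
    then have "mdeg \<delta> \<le> 1" using Rep_index2[of \<gamma>] by simp
    then show ?thesis using d(1) mdeg_single[of i 1] by (metis le_refl)
  qed
  then obtain a b where "mdeg a \<le> 1" "mdeg b \<le> 1" "Rep_index2 \<gamma> = a + b" by blast
  then have "Rep_index2 \<gamma> = Rep_index2 (index_add (Abs_index1 a) (Abs_index1 b))"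
    by (simp add: Rep_index_add Abs_index1_inverse)
  then show ?thesis using Rep_index2_inject by blast
qed

text \<open>The choice is harmless: by \<open>index_add_eq_iff\<close> the two factors are determined up to their order.\<close>

definition index_factors :: "('n::finite) index2 \<Rightarrow> 'n index1 \<times> 'n index1" where
  "index_factors \<gamma> = (SOME p. \<gamma> = index_add (fst p) (snd p))"

lemma index_add_factors: "index_add (fst (index_factors \<gamma>)) (snd (index_factors \<gamma>)) = \<gamma>"
proof -
  have "\<exists>p. \<gamma> = index_add (fst p) (snd p)" using ex_index_add[of \<gamma>] by simp
  then show ?thesis unfolding index_factors_def by (metis (mono_tags, lifting) someI_ex)
qed

definition const_index :: "('n::finite) index1" where
  "const_index = Abs_index1 0"

lemma Rep_const_index: "Rep_index1 const_index = 0"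
  by (simp add: const_index_def Abs_index1_inverse mdeg_def)

definition var_index :: "'n::finite \<Rightarrow> 'n index1" where
  "var_index i = Abs_index1 (Poly_Mapping.single i 1)"

lemma Rep_var_index: "Rep_index1 (var_index i) = Poly_Mapping.single i 1"
  using mdeg_single[of i 1] by (simp add: var_index_def Abs_index1_inverse)

lemma index1_cases:
  obtains "\<alpha> = const_index" | i where "\<alpha> = var_index i"
proof -
  have "mdeg (Rep_index1 \<alpha>) \<le> 1" using Rep_index1[of \<alpha>] by simp
  then show ?thesis
  proof (cases rule: mdeg_le_1_cases)
    case 1
    then show ?thesis using that(1) by (metis Rep_const_index Rep_index1_inject)
  next
    case (2 i)
    then show ?thesis using that(2) by (metis Rep_var_index Rep_index1_inject)
  qed
qed

section \<open>Homogeneous coordinates\<close>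

text \<open>The family whose moment matrix is \<open>w w\<^sup>T\<close>.\<close>

definition square_moments :: "real ^ ('n::finite) index1 \<Rightarrow> 'n moments2" where
  "square_moments w = (\<chi> \<gamma>. w $ fst (index_factors \<gamma>) * w $ snd (index_factors \<gamma>))"

lemma square_moments_index_add: "square_moments w $ index_add \<alpha> \<beta> = w $ \<alpha> * w $ \<beta>"
  using index_add_factors[of "index_add \<alpha> \<beta>"]
  by (auto simp: square_moments_def index_add_eq_iff)

lemma square_moments_scaleR: "square_moments (c *\<^sub>R w) = c\<^sup>2 *\<^sub>R square_moments w"
  by (simp add: vec_eq_iff square_moments_def power2_eq_square mult_ac)

lemma continuous_square_moments: "continuous_on UNIV square_moments"
  unfolding square_moments_def by (intro continuous_intros)

definition lift_point :: "real ^ 'n \<Rightarrow> real ^ ('n::finite) index1" where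
  "lift_point x = (\<chi> \<alpha>. monomial_at (Rep_index1 \<alpha>) x)"

definition point_moments :: "real ^ 'n \<Rightarrow> ('n::finite) moments2" where
  "point_moments x = (\<chi> \<gamma>. monomial_at (Rep_index2 \<gamma>) x)"

lemma monomial_at_add: "monomial_at (\<alpha> + \<beta>) x = monomial_at \<alpha> x * monomial_at \<beta> x"
  by (simp add: monomial_at_def lookup_add power_add prod.distrib)

lemma monomial_at_0: "monomial_at 0 x = 1"
  by (simp add: monomial_at_def)

lemma monomial_at_single: "monomial_at (Poly_Mapping.single i 1) x = x $ i"
proof -
  have "monomial_at (Poly_Mapping.single i 1) x = (\<Prod>j\<in>UNIV. if j = i then x $ j else 1)"
    unfolding monomial_at_def by (intro prod.cong) (auto simp: lookup_single when_def)
  then show ?thesis by simp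
qed

lemma square_moments_lift_point: "square_moments (lift_point x) = point_moments x"
proof -
  have "square_moments (lift_point x) $ \<gamma> = point_moments x $ \<gamma>" for \<gamma>
  proof -
    obtain \<alpha> \<beta> where "\<gamma> = index_add \<alpha> \<beta>" using ex_index_add by blast
    then show ?thesis
      by (simp add: square_moments_index_add lift_point_def point_moments_def Rep_index_add
          monomial_at_add)
  qed
  then show ?thesis by (simp add: vec_eq_iff)
qed

lemma lift_point_const: "lift_point x $ const_index = 1"
  by (simp add: lift_point_def Rep_const_index monomial_at_0)

text \<open>A vector with nonzero constant entry represents an affine point, obtained by dividing the
  other entries by it.\<close>

lemma dehomogenize:
  assumes "w $ const_index \<noteq> 0"
  shows "\<exists>x. w = (w $ const_index) *\<^sub>R lift_point x"
proof
  let ?x = "\<chi> i. w $ var_index i / w $ const_index"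
  have "w $ \<alpha> = w $ const_index * lift_point ?x $ \<alpha>" for \<alpha>
  proof (cases \<alpha> rule: index1_cases)
    case 1
    then show ?thesis by (simp add: lift_point_const)
  next
    case (2 i)
    have "lift_point ?x $ \<alpha> = w $ var_index i / w $ const_index"
      unfolding 2 lift_point_def vec_lambda_beta Rep_var_index monomial_at_single by simp
    then show ?thesis using assms 2 by simp
  qed
  then show "w = (w $ const_index) *\<^sub>R lift_point ?x"
    unfolding vec_eq_iff vector_scaleR_component real_scaleR_def by blast
qed

text \<open>The polarization of the quadratic form \<open>t\<^sup>2 q(u / t)\<close> in the homogeneous coordinates \<open>(t, u)\<close>.
  Averaging over the two orders of the factors makes it symmetric.\<close>

definition homogenized_form ::
    "('n::finite) real_mpoly \<Rightarrow> real ^ 'n index1 \<Rightarrow> real ^ 'n index1 \<Rightarrow> real" where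
  "homogenized_form q v w = (\<Sum>\<gamma>\<in>UNIV. Poly_Mapping.lookup q (Rep_index2 \<gamma>) / 2 *
     (v $ fst (index_factors \<gamma>) * w $ snd (index_factors \<gamma>) +
      v $ snd (index_factors \<gamma>) * w $ fst (index_factors \<gamma>)))"

lemma bilinear_homogenized_form: "bilinear (homogenized_form q)"
  unfolding bilinear_def linear_iff homogenized_form_def
  by (simp add: algebra_simps sum.distrib sum_distrib_left)

lemma homogenized_form_commute: "homogenized_form q v w = homogenized_form q w v"
  unfolding homogenized_form_def by (intro sum.cong refl) (simp add: algebra_simps)

lemma homogenized_form_eq_riesz: "homogenized_form q w w = riesz (square_moments w) q"
  unfolding homogenized_form_def riesz_def square_moments_def
  by (intro sum.cong refl) (simp add: algebra_simps)

lemma riesz_sum_square_moments: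
  "riesz (\<Sum>w\<leftarrow>ws. square_moments w) q = (\<Sum>w\<leftarrow>ws. homogenized_form q w w)"
  by (induction ws) (simp_all add: homogenized_form_eq_riesz riesz_def distrib_left sum.distrib)

lemma quadratic_keys:
  assumes "quadratic q" "\<gamma> \<in> Poly_Mapping.keys q"
  shows "mdeg \<gamma> \<le> 2"
proof -
  have "mdeg \<gamma> \<le> total_degree q"
    unfolding total_degree_def using assms(2) by (intro Max_ge) auto
  then show ?thesis using assms(1) by (simp add: quadratic_def)
qed

lemma riesz_point_moments:
  assumes "quadratic q"
  shows "riesz (point_moments x) q = mpoly_eval q x"
proof -
  have "Poly_Mapping.keys q \<subseteq> range Rep_index2"
    using quadratic_keys[OF assms] by (auto simp: type_definition.Rep_range[OF type_definition_index2])
  then have "mpoly_eval q x = (\<Sum>\<gamma>\<in>range Rep_index2. Poly_Mapping.lookup q \<gamma> * monomial_at \<gamma> x)"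
    unfolding mpoly_eval_def by (intro sum.mono_neutral_left) (auto simp: in_keys_iff)
  also have "\<dots> = riesz (point_moments x) q"
    unfolding riesz_def point_moments_def
    by (subst sum.reindex) (auto simp: inj_on_def Rep_index2_inject)
  finally show ?thesis by simp
qed

lemma homogenized_form_lift_point:
  assumes "quadratic q"
  shows "homogenized_form q (lift_point x) (lift_point x) = mpoly_eval q x"
  by (simp add: homogenized_form_eq_riesz square_moments_lift_point riesz_point_moments assms)

text \<open>A monomial of degree two in \<open>q\<close> factors into two variables \<open>i\<close> and \<open>j\<close>, and it alone contributes to
  \<open>B(e\<^sub>i, e\<^sub>j)\<close>. By polarization \<open>B\<close> cannot be isotropic at all of \<open>e\<^sub>i\<close>, \<open>e\<^sub>j\<close> and \<open>e\<^sub>i + e\<^sub>j\<close>.\<close>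

lemma homogenized_form_nonzero_at_infinity:
  fixes q :: "('n::finite) real_mpoly"
  assumes "quadratic q"
  shows "\<exists>v. v $ const_index = 0 \<and> homogenized_form q v v \<noteq> 0"
proof -
  let ?B = "homogenized_form q"
  have "Max (insert 0 (mdeg ` Poly_Mapping.keys q)) = 2"
    using assms by (simp add: quadratic_def total_degree_def)
  then have "2 \<in> insert 0 (mdeg ` Poly_Mapping.keys q)"
    by (metis Max_in finite.insertI finite_imageI finite_keys insert_not_empty)
  then obtain g where g: "g \<in> Poly_Mapping.keys q" "mdeg g = 2" by auto
  define \<gamma>0 where "\<gamma>0 = (Abs_index2 g :: 'n index2)"
  have R0: "Rep_index2 \<gamma>0 = g" using g by (simp add: \<gamma>0_def Abs_index2_inverse)
  obtain i j where ij: "\<gamma>0 = index_add i j" using ex_index_add by blast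
  have "mdeg (Rep_index1 i) + mdeg (Rep_index1 j) = 2"
    using g R0 ij by (metis Rep_index_add mdeg_add)
  then have "mdeg (Rep_index1 i) = 1" "mdeg (Rep_index1 j) = 1"
    using Rep_index1[of i] Rep_index1[of j] by auto
  then have nc: "i \<noteq> const_index" "j \<noteq> const_index"
    using Rep_const_index mdeg_eq_0_iff by (metis zero_neq_one)+
  have only: "axis i 1 $ fst (index_factors \<gamma>) * axis j 1 $ snd (index_factors \<gamma>) +
      axis i 1 $ snd (index_factors \<gamma>) * axis j 1 $ fst (index_factors \<gamma>) = (0::real)"
    if "\<gamma> \<noteq> \<gamma>0" for \<gamma>
    using that index_add_factors[of \<gamma>] ij
    by (auto simp: axis_def index_add_commute split: if_splits)
  have "?B (axis i 1) (axis j 1) =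
      Poly_Mapping.lookup q (Rep_index2 \<gamma>0) / 2 *
     (axis i 1 $ fst (index_factors \<gamma>0) * axis j 1 $ snd (index_factors \<gamma>0) +
      axis i 1 $ snd (index_factors \<gamma>0) * axis j 1 $ fst (index_factors \<gamma>0))"
    unfolding homogenized_form_def
    by (rule sum.remove[of UNIV \<gamma>0, THEN trans]) (auto simp: only intro!: sum.neutral)
  also have "\<dots> \<noteq> 0"
    using g R0 index_add_factors[of \<gamma>0] ij
    by (auto simp: axis_def index_add_eq_iff in_keys_iff)
  finally have ne: "?B (axis i 1) (axis j 1) \<noteq> 0" .
  have "?B (axis i 1 + axis j 1) (axis i 1 + axis j 1) =
      ?B (axis i 1) (axis i 1) + 2 * ?B (axis i 1) (axis j 1) + ?B (axis j 1) (axis j 1)"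
    using homogenized_form_commute[of q "axis j 1" "axis i 1"]
    by (simp add: bilinear_ladd[OF bilinear_homogenized_form] bilinear_radd[OF bilinear_homogenized_form])
  then have "?B (axis i 1) (axis i 1) \<noteq> 0 \<or> ?B (axis j 1) (axis j 1) \<noteq> 0 \<or>
      ?B (axis i 1 + axis j 1) (axis i 1 + axis j 1) \<noteq> 0"
    using ne by auto
  moreover have "axis i (1::real) $ const_index = 0" "axis j (1::real) $ const_index = 0"
    using nc by (auto simp: axis_def)
  ultimately show ?thesis by (metis add_0 vector_add_component)
qed

lemma moments_eq_sum_square_moments:
  fixes y :: "('n::finite) moments2"
  assumes "pos_semidef (moment_matrix1 y)"
  shows "\<exists>ws. y = (\<Sum>w\<leftarrow>ws. square_moments w)"
proof -
  obtain ws where ws: "\<And>\<alpha> \<beta>. moment_matrix1 y $ \<alpha> $ \<beta> = (\<Sum>w\<leftarrow>ws. w $ \<alpha> * w $ \<beta>)"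
    using pos_semidef_sum_rank_one[OF assms] by blast
  have "y $ \<gamma> = (\<Sum>w\<leftarrow>ws. square_moments w) $ \<gamma>" for \<gamma>
  proof -
    obtain \<alpha> \<beta> where g: "\<gamma> = index_add \<alpha> \<beta>" using ex_index_add by blast
    have "(\<Sum>w\<leftarrow>us. square_moments w) $ \<gamma> = (\<Sum>w\<leftarrow>us. w $ \<alpha> * w $ \<beta>)" for us
      by (induction us) (simp_all add: g square_moments_index_add)
    then show ?thesis using ws[of \<alpha> \<beta>] by (simp add: moment_matrix1_def g)
  qed
  then show ?thesis by (auto simp: vec_eq_iff)
qed

lemma moments_eq_sum_square_moments_nonneg:
  fixes y :: "('n::finite) moments2"
  assumes psd: "pos_semidef (moment_matrix1 y)" and nn: "riesz y q \<ge> 0"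
  shows "\<exists>ws. y = (\<Sum>w\<leftarrow>ws. square_moments w) \<and> (\<forall>w\<in>set ws. homogenized_form q w w \<ge> 0)"
proof -
  let ?B = "homogenized_form q"
  obtain ws where y: "y = (\<Sum>w\<leftarrow>ws. square_moments w)"
    using moments_eq_sum_square_moments[OF psd] by blast
  have comp: "(\<Sum>w\<leftarrow>us. square_moments w) $ \<gamma> =
      (\<Sum>w\<leftarrow>us. w $ fst (index_factors \<gamma>) * w $ snd (index_factors \<gamma>))"
    for us :: "(real ^ 'n index1) list" and \<gamma>
    by (induction us) (simp_all add: square_moments_def)
  have "(\<Sum>w\<leftarrow>ws. ?B w w) \<ge> 0" using nn y by (simp add: riesz_sum_square_moments)
  from rank_one_sum_rebalance[OF bilinear_homogenized_form this]
  obtain ws' where ws': "\<And>h. bilinear h \<Longrightarrow> (\<Sum>w\<leftarrow>ws'. h w w) = (\<Sum>w\<leftarrow>ws. h w w :: real)"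
    "\<forall>w\<in>set ws'. ?B w w \<ge> 0" by blast
  \<comment> \<open>The coordinate products are bilinear, so rebalancing preserves the family itself.\<close>
  have "bilinear (\<lambda>v w :: real ^ 'n index1. v $ \<alpha> * w $ \<beta>)" for \<alpha> \<beta>
    by (simp add: bilinear_def linear_iff algebra_simps)
  from ws'(1)[OF this] have "y = (\<Sum>w\<leftarrow>ws'. square_moments w)"
    by (simp add: vec_eq_iff y comp)
  then show ?thesis using ws'(2) by blast
qed

section \<open>Atomic measures\<close>

text \<open>Moments of finitely atomic measures, with the atoms and their masses listed, so that adding two
  measures amounts to concatenating lists.\<close>

definition atomic_moments :: "(real ^ 'n) set \<Rightarrow> (('n::finite) moments2) set" where
  "atomic_moments K =
     {\<Sum>(c, x)\<leftarrow>ps. c *\<^sub>R point_moments x |ps. \<forall>(c, x)\<in>set ps. c \<ge> 0 \<and> x \<in> K}"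

lemma borel_measurable_monomial_at [measurable]: "monomial_at \<alpha> \<in> borel_measurable borel"
  unfolding monomial_at_def by measurable

lemma atomic_moments_subset:
  assumes K: "K \<in> sets borel"
  shows "atomic_moments K \<subseteq> moment_cone2 K"
proof
  fix y :: "'a moments2" assume "y \<in> atomic_moments K"
  then obtain ps where y: "y = (\<Sum>(c, x)\<leftarrow>ps. c *\<^sub>R point_moments x)"
    and ps: "\<And>c x. (c, x) \<in> set ps \<Longrightarrow> c \<ge> 0 \<and> x \<in> K"
    unfolding atomic_moments_def by blast
  define I where "I = {..<length ps}"
  define N where "N = point_measure I (\<lambda>k. ennreal (fst (ps ! k)))"
  define X where "X = (\<lambda>k. snd (ps ! k))"
  define \<mu> where "\<mu> = distr N borel X"
  have nn: "fst (ps ! k) \<ge> 0" "X k \<in> K" if "k \<in> I" for k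
    using that ps[of "fst (ps ! k)" "snd (ps ! k)"] by (auto simp: I_def X_def)
  have [measurable]: "X \<in> N \<rightarrow>\<^sub>M borel"
    by (simp add: N_def measurable_point_measure_eq1)
  have int: "integrable N f" for f :: "nat \<Rightarrow> real"
    unfolding N_def by (rule integrable_point_measure_finite) (simp add: I_def)
  have "integrable \<mu> (monomial_at \<alpha>)" for \<alpha>
    unfolding \<mu>_def by (simp add: integrable_distr_eq int)
  moreover have "y $ \<alpha> = integral\<^sup>L \<mu> (monomial_at (Rep_index2 \<alpha>))" for \<alpha>
  proof -
    have "integral\<^sup>L \<mu> (monomial_at (Rep_index2 \<alpha>)) =
        (\<Sum>k\<in>I. fst (ps ! k) * monomial_at (Rep_index2 \<alpha>) (X k))"
    proof -
      have "integral\<^sup>L \<mu> (monomial_at (Rep_index2 \<alpha>)) = (\<integral>k. monomial_at (Rep_index2 \<alpha>) (X k) \<partial>N)"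
        unfolding \<mu>_def by (rule integral_distr) simp_all
      also have "\<dots> = (\<Sum>k\<in>I. fst (ps ! k) *\<^sub>R monomial_at (Rep_index2 \<alpha>) (X k))"
        unfolding N_def
        by (rule lebesgue_integral_point_measure_finite) (use nn in \<open>auto simp: I_def\<close>)
      finally show ?thesis by simp
    qed
    also have "\<dots> = (\<Sum>(c, x)\<leftarrow>ps. c * monomial_at (Rep_index2 \<alpha>) x)"
      by (simp add: sum_list_sum_nth I_def X_def case_prod_beta atLeast0LessThan)
    also have "\<dots> = (\<Sum>(c, x)\<leftarrow>ps. c *\<^sub>R point_moments x) $ \<alpha>"
      by (induction ps) (auto simp: point_moments_def)
    finally show ?thesis by (simp add: y)
  qed
  moreover have "AE x in \<mu>. x \<in> K"
    unfolding \<mu>_def using K nn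
    by (subst AE_distr_iff) (auto simp: N_def space_point_measure AE_point_measure)
  moreover have "sets \<mu> = sets borel" by (simp add: \<mu>_def)
  ultimately show "y \<in> moment_cone2 K" unfolding moment_cone2_def by blast
qed

lemma closure_atomic_moments_add:
  assumes "a \<in> closure (atomic_moments K)" "b \<in> closure (atomic_moments K)"
  shows "a + b \<in> closure (atomic_moments K)"
proof -
  \<comment> \<open>The cone is closed under addition, and hence so is its closure.\<close>
  have add: "a + b \<in> atomic_moments K"
    if ab: "a \<in> atomic_moments K" "b \<in> atomic_moments K" for a b
  proof -
    obtain ps where ps: "a = (\<Sum>(c, x)\<leftarrow>ps. c *\<^sub>R point_moments x)"
        "\<forall>(c, x)\<in>set ps. c \<ge> 0 \<and> x \<in> K"
      using ab(1) unfolding atomic_moments_def by blast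
    obtain rs where rs: "b = (\<Sum>(c, x)\<leftarrow>rs. c *\<^sub>R point_moments x)"
        "\<forall>(c, x)\<in>set rs. c \<ge> 0 \<and> x \<in> K"
      using ab(2) unfolding atomic_moments_def by blast
    have "a + b = (\<Sum>(c, x)\<leftarrow>ps @ rs. c *\<^sub>R point_moments x) \<and>
        (\<forall>(c, x)\<in>set (ps @ rs). c \<ge> 0 \<and> x \<in> K)"
      using ps rs by auto
    then show ?thesis unfolding atomic_moments_def by blast
  qed
  obtain f where f: "\<And>k. f k \<in> atomic_moments K" "f \<longlonglongrightarrow> a"
    using assms(1) closure_sequential by blast
  obtain g where g: "\<And>k. g k \<in> atomic_moments K" "g \<longlonglongrightarrow> b"
    using assms(2) closure_sequential by blast
  show ?thesis
    unfolding closure_sequential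
    using add f g by (intro exI[of _ "\<lambda>k. f k + g k"]) (auto intro: tendsto_add)
qed

lemma closure_atomic_moments_sum_list:
  assumes "\<And>w. w \<in> set ws \<Longrightarrow> f w \<in> closure (atomic_moments K)"
  shows "(\<Sum>w\<leftarrow>ws. f w) \<in> closure (atomic_moments K)"
  using assms
proof (induction ws)
  case Nil
  have "0 \<in> atomic_moments K" unfolding atomic_moments_def by (auto intro: exI[of _ "[]"])
  then show ?case using closure_subset by auto
next
  case (Cons w ws)
  then show ?case by (simp add: closure_atomic_moments_add)
qed

text \<open>Points off the hyperplane at infinity give single atoms, and \<open>square_moments\<close> is continuous, so
  approximating a vector suffices to approximate its moment family. The predicate \<open>P\<close> is
  the condition on the homogenized form that puts the atom in \<open>K\<close>.\<close>

lemma square_moments_in_closure: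
  assumes w: "w \<in> closure {w. w $ const_index \<noteq> 0 \<and> P w}"
    and P: "\<And>c x. c \<noteq> 0 \<Longrightarrow> P (c *\<^sub>R lift_point x) \<Longrightarrow> x \<in> K"
  shows "square_moments w \<in> closure (atomic_moments K)"
proof -
  let ?T = "{w. w $ const_index \<noteq> 0 \<and> P w}"
  have "square_moments w' \<in> atomic_moments K" if "w' \<in> ?T" for w'
  proof -
    obtain x where x: "w' = (w' $ const_index) *\<^sub>R lift_point x"
      using \<open>w' \<in> ?T\<close> dehomogenize by blast
    define c where "c = w' $ const_index"
    have w': "w' = c *\<^sub>R lift_point x" using x by (simp add: c_def)
    then have "x \<in> K" using that P[of c x] by (simp add: c_def)
    then show ?thesis
      unfolding atomic_moments_def w'
      by (auto intro!: exI[of _ "[(c\<^sup>2, x)]"] simp: square_moments_scaleR square_moments_lift_point)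
  qed
  then have "square_moments ` ?T \<subseteq> closure (atomic_moments K)"
    using closure_subset by blast
  then have "square_moments ` closure ?T \<subseteq> closure (atomic_moments K)"
    by (intro image_closure_subset)
       (auto intro: continuous_on_subset[OF continuous_square_moments])
  then show ?thesis using w by blast
qed

section \<open>The cone described by the moment matrix is closed\<close>

lemma moment_matrix1_form:
  "v \<bullet> (moment_matrix1 y *v v) = (\<Sum>\<alpha>\<in>UNIV. \<Sum>\<beta>\<in>UNIV. v $ \<alpha> * (v $ \<beta> * y $ index_add \<alpha> \<beta>))"
  by (simp add: inner_vec_def matrix_vector_mult_def moment_matrix1_def sum_distrib_left mult_ac)

lemma pos_semidef_moment_matrix1_iff:
  "pos_semidef (moment_matrix1 y) \<longleftrightarrow> (\<forall>v. 0 \<le> v \<bullet> (moment_matrix1 y *v v))"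
  unfolding pos_semidef_def
  by (simp add: vec_eq_iff transpose_def moment_matrix1_def index_add_commute)

lemma continuous_riesz: "continuous_on UNIV (\<lambda>y. riesz y q)"
  unfolding riesz_def by (intro continuous_intros)

lemma closed_pos_semidef_moments: "closed {y. pos_semidef (moment_matrix1 y)}"
  unfolding pos_semidef_moment_matrix1_iff moment_matrix1_form
  by (intro closed_Collect_all closed_Collect_le continuous_intros)

lemma moment_cone2_pos_semidef:
  assumes "y \<in> moment_cone2 K"
  shows "pos_semidef (moment_matrix1 y)"
proof -
  obtain \<mu> :: "(real ^ 'a) measure" where
    int: "\<And>\<alpha>. integrable \<mu> (monomial_at (Rep_index2 \<alpha>))"
    and y: "\<And>\<alpha>. y $ \<alpha> = integral\<^sup>L \<mu> (monomial_at (Rep_index2 \<alpha>))"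
    using assms unfolding moment_cone2_def by blast
  have "0 \<le> v \<bullet> (moment_matrix1 y *v v)" for v
  proof -
    have "v \<bullet> (moment_matrix1 y *v v) = (\<integral>x. (\<Sum>\<alpha>\<in>UNIV. \<Sum>\<beta>\<in>UNIV. v $ \<alpha> *
        (v $ \<beta> * monomial_at (Rep_index2 (index_add \<alpha> \<beta>)) x)) \<partial>\<mu>)"
      by (simp add: moment_matrix1_form y int Bochner_Integration.integral_sum)
    also have "\<dots> = (\<integral>x. (\<Sum>\<alpha>\<in>UNIV. v $ \<alpha> * monomial_at (Rep_index1 \<alpha>) x)\<^sup>2 \<partial>\<mu>)"
      by (simp add: Rep_index_add monomial_at_add power2_eq_square sum_product mult_ac)
    also have "\<dots> \<ge> 0" by simp
    finally show ?thesis .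
  qed
  then show ?thesis by (simp add: pos_semidef_moment_matrix1_iff)
qed

lemma moment_cone2_riesz:
  assumes "quadratic q" "y \<in> moment_cone2 K"
  shows "\<exists>\<mu>. (AE x in \<mu>. x \<in> K) \<and> riesz y q = (\<integral>x. mpoly_eval q x \<partial>\<mu>)"
proof -
  obtain \<mu> :: "(real ^ 'a) measure" where
    int: "\<And>\<alpha>. integrable \<mu> (monomial_at (Rep_index2 \<alpha>))"
    and y: "\<And>\<alpha>. y $ \<alpha> = integral\<^sup>L \<mu> (monomial_at (Rep_index2 \<alpha>))"
    and AE: "AE x in \<mu>. x \<in> K"
    using assms(2) unfolding moment_cone2_def by blast
  have "riesz y q = (\<integral>x. riesz (point_moments x) q \<partial>\<mu>)"
    unfolding riesz_def point_moments_def by (simp add: y int Bochner_Integration.integral_sum)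
  then show ?thesis using AE assms(1) by (auto simp: riesz_point_moments)
qed

lemma moment_cone2_nonneg_set:
  assumes "quadratic q" "y \<in> moment_cone2 (nonneg_set q)"
  shows "riesz y q \<ge> 0"
  using moment_cone2_riesz[OF assms]
  by (auto simp: nonneg_set_def intro!: integral_nonneg_AE)

lemma moment_cone2_zero_set:
  assumes "quadratic q" "y \<in> moment_cone2 (zero_set q)"
  shows "riesz y q = 0"
  using moment_cone2_riesz[OF assms]
  by (auto simp: zero_set_def intro!: integral_eq_zero_AE)

lemma continuous_mpoly_eval: "continuous_on UNIV (mpoly_eval q)"
  unfolding mpoly_eval_def monomial_at_def by (intro continuous_intros)

lemma borel_zero_set: "zero_set q \<in> sets borel"
  unfolding zero_set_def
  by (intro borel_closed closed_Collect_eq continuous_mpoly_eval continuous_intros)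

lemma borel_nonneg_set: "nonneg_set q \<in> sets borel"
  unfolding nonneg_set_def
  by (intro borel_closed closed_Collect_le continuous_mpoly_eval continuous_intros)

section \<open>Closures of quadratic moment cones\<close>

text \<open>After rebalancing, the values of the form on the summands are nonnegative with sum \<open>L\<^sub>y(q) = 0\<close>, hence
  zero, so each summand is an atom in \<open>E(q)\<close> or a limit of such atoms.\<close>

lemma closure_moment_cone2_zero_set:
  assumes q: "quadratic q" and ne: "zero_set q \<noteq> {}"
    and psd: "pos_semidef (moment_matrix1 y)" and r: "riesz y q = 0"
  shows "y \<in> closure (moment_cone2 (zero_set q))"
proof -
  let ?B = "homogenized_form q" and ?t = "\<lambda>w :: real ^ 'a index1. w $ const_index"
  note bil = bilinear_homogenized_form[of q]
  obtain ws where y: "y = (\<Sum>w\<leftarrow>ws. square_moments w)" and nn: "\<forall>w\<in>set ws. ?B w w \<ge> 0"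
    using moments_eq_sum_square_moments_nonneg[OF psd, of q] r by auto
  have "(\<Sum>w\<leftarrow>ws. ?B w w) = 0" using r y by (simp add: riesz_sum_square_moments)
  then have zero: "?B w w = 0" if "w \<in> set ws" for w
    using that nn sum_list_nonneg_eq_0_iff[of "map (\<lambda>w. ?B w w) ws"] by auto
  obtain x0 where x0: "mpoly_eval q x0 = 0" using ne by (auto simp: zero_set_def)
  obtain v where v: "?t v = 0" "?B v v \<noteq> 0"
    using homogenized_form_nonzero_at_infinity[OF q] by blast
  have lin: "linear ?t" by (simp add: linear_iff)
  have "w \<in> closure {w. ?t w \<noteq> 0 \<and> ?B w w = 0}" if "w \<in> set ws" for w
  proof (cases "?t w = 0")
    case True
    show ?thesis
      by (rule isotropic_in_closure_off_hyperplane[OF bil homogenized_form_commute lin True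
            zero[OF that] _ _ v, of "lift_point x0"])
         (simp_all add: lift_point_const homogenized_form_lift_point q x0)
  next
    case False
    then show ?thesis by (intro subsetD[OF closure_subset]) (simp add: zero[OF that])
  qed
  moreover have "x \<in> zero_set q" if "c \<noteq> 0" "?B (c *\<^sub>R lift_point x) (c *\<^sub>R lift_point x) = 0" for c x
    using that by (simp add: bilinear_lmul[OF bil] bilinear_rmul[OF bil]
        homogenized_form_lift_point q zero_set_def)
  ultimately have "y \<in> closure (atomic_moments (zero_set q))"
    unfolding y
    by (intro closure_atomic_moments_sum_list
        square_moments_in_closure[where P = "\<lambda>w. ?B w w = 0"]) simp_all
  then show ?thesis
    by (rule subsetD[OF closure_mono[OF atomic_moments_subset[OF borel_zero_set]]])
qed

lemma closure_moment_cone2_nonneg_set: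
  assumes q: "quadratic q" and ne: "nonneg_set q \<noteq> {}"
    and psd: "pos_semidef (moment_matrix1 y)" and r: "riesz y q \<ge> 0"
  shows "y \<in> closure (moment_cone2 (nonneg_set q))"
proof -
  let ?B = "homogenized_form q" and ?t = "\<lambda>w :: real ^ 'a index1. w $ const_index"
  note bil = bilinear_homogenized_form[of q]
  obtain ws where y: "y = (\<Sum>w\<leftarrow>ws. square_moments w)" and nn: "\<forall>w\<in>set ws. ?B w w \<ge> 0"
    using moments_eq_sum_square_moments_nonneg[OF psd r] by auto
  obtain x0 where x0: "mpoly_eval q x0 \<ge> 0" using ne by (auto simp: nonneg_set_def)
  obtain v where v: "?t v = 0" "?B v v \<noteq> 0"
    using homogenized_form_nonzero_at_infinity[OF q] by blast
  have lin: "linear ?t" by (simp add: linear_iff)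
  have "w \<in> closure {w. ?t w \<noteq> 0 \<and> ?B w w \<ge> 0}" if "w \<in> set ws" for w
  proof (cases "?t w = 0")
    case True
    show ?thesis
      by (rule nonneg_in_closure_off_hyperplane[OF bil homogenized_form_commute lin True
            nn[rule_format, OF that] _ _ v, of "lift_point x0"])
         (simp_all add: lift_point_const homogenized_form_lift_point q x0)
  next
    case False
    then show ?thesis by (intro subsetD[OF closure_subset]) (simp add: nn that)
  qed
  moreover have "x \<in> nonneg_set q" if "c \<noteq> 0" "?B (c *\<^sub>R lift_point x) (c *\<^sub>R lift_point x) \<ge> 0" for c x
  proof -
    have "0 \<le> c\<^sup>2 * mpoly_eval q x"
      using that by (simp add: bilinear_lmul[OF bil] bilinear_rmul[OF bil]
          homogenized_form_lift_point q power2_eq_square)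
    then show ?thesis using \<open>c \<noteq> 0\<close> by (simp add: nonneg_set_def zero_le_mult_iff)
  qed
  ultimately have "y \<in> closure (atomic_moments (nonneg_set q))"
    unfolding y
    by (intro closure_atomic_moments_sum_list
        square_moments_in_closure[where P = "\<lambda>w. ?B w w \<ge> 0"]) simp_all
  then show ?thesis
    by (rule subsetD[OF closure_mono[OF atomic_moments_subset[OF borel_nonneg_set]]])
qed

theorem theorem4p8:
  fixes y :: "('n::finite) moments2" and q :: "'n real_mpoly"
  assumes "quadratic q"
  shows "(zero_set q \<noteq> {} \<longrightarrow>
            (pos_semidef (moment_matrix1 y) \<and> riesz y q = 0
              \<longleftrightarrow> y \<in> closure (moment_cone2 (zero_set q)))) \<and>
         (nonneg_set q \<noteq> {} \<longrightarrow>
            (pos_semidef (moment_matrix1 y) \<and> riesz y q \<ge> 0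
              \<longleftrightarrow> y \<in> closure (moment_cone2 (nonneg_set q))))"
proof (intro conjI impI iffI; (elim conjE)?)
  assume "y \<in> closure (moment_cone2 (zero_set q))"
  moreover have "closed ({y. pos_semidef (moment_matrix1 y)} \<inter> {y. riesz y q = 0})"
    by (intro closed_Int closed_pos_semidef_moments closed_Collect_eq continuous_riesz continuous_intros)
  then have "closure (moment_cone2 (zero_set q)) \<subseteq>
      {y. pos_semidef (moment_matrix1 y)} \<inter> {y. riesz y q = 0}"
    by (intro closure_minimal) (auto simp: moment_cone2_pos_semidef moment_cone2_zero_set assms)
  ultimately show "pos_semidef (moment_matrix1 y)" "riesz y q = 0" by auto
next
  assume "y \<in> closure (moment_cone2 (nonneg_set q))"
  moreover have "closed ({y. pos_semidef (moment_matrix1 y)} \<inter> {y. riesz y q \<ge> 0})"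
    by (intro closed_Int closed_pos_semidef_moments closed_Collect_le continuous_riesz continuous_intros)
  then have "closure (moment_cone2 (nonneg_set q)) \<subseteq>
      {y. pos_semidef (moment_matrix1 y)} \<inter> {y. riesz y q \<ge> 0}"
    by (intro closure_minimal) (auto simp: moment_cone2_pos_semidef moment_cone2_nonneg_set assms)
  ultimately show "pos_semidef (moment_matrix1 y)" "riesz y q \<ge> 0" by auto
qed (simp_all add: closure_moment_cone2_zero_set closure_moment_cone2_nonneg_set assms)

end
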